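(* Let $G_1$ and $G_2$ be graphs with $n_1$ and $n_2$ vertices respectively, let $t$ be a positive integer, and let $G$ be a $t$-connected sum of $G_1$ and $G_2$. Then for every nonnegative integer $k$, $$b_k(G)=\sum_{i=0}^k\left(b_i(G_1)\binom{n_2-t}{k-i}+b_i(G_2)\binom{n_1-t}{k-i}\right)+\binom{n_1+n_2-2t}{k}.$$
   Context: All graphs are simple. For a graph $G$ with vertex set $V$ and $W\subset V$, $G|_W$ is the induced subgraph on $W$, and $\mathrm{nc}(G|_W)$ is its number of connected components (so $\mathrm{nc}(G|_\emptyset)=0$). Define $b_k(G)=\sum_{W\subset V,\,|W|=k}(\mathrm{nc}(G|_W)-1)$ (so $b_0(G)=-1$ and $b_k(G)=0$ for $k>|V|$). Connected sum of graphs: let $G_1,G_2$ be graphs with vertex sets $V_1,V_2$ and edge sets $E_1,E_2$; let $F_1\subset V_1$, $F_2\subset V_2$ with $|F_1|=|F_2|=t$ such that $G_1|_{F_1}$ and $G_2|_{F_2}$ are complete graphs; let $\sigma:V_2\to V_2'$ be a bijection onto a finite set $V_2'$ with $V_1\cap V_2'=F_1$ and $\sigma(F_2)=F_1$. The graph with vertex set $V_1\cup V_2'$ and edge set $E_1\cup\{\{\sigma(x),\sigma(y)\}:\{x,y\}\in E_2\}$ is called a $t$-connected sum of $G_1$ and $G_2$. *)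

theory Defs
  imports "Graph_Theory.Graph_Theory"
begin

text \<open>
  Following the Graph_Theory library, a finite simple graph is a finite, loop-free, symmetric
  digraph (locale \<^locale>\<open>pair_graph\<close>): the edge \<open>{x, y}\<close> is represented by the two arcs
  \<open>(x, y)\<close> and \<open>(y, x)\<close>. For such a graph the connected components are exactly the
  strongly connected components \<^const>\<open>pre_digraph.sccs\<close>, which are non-empty by definition, so
  that the null graph has none.
\<close>

definition num_components :: "('a, 'b) pre_digraph \<Rightarrow> nat" where
  "num_components G = card (pre_digraph.sccs G)"

definition graph_b :: "nat \<Rightarrow> 'a pair_pre_digraph \<Rightarrow> int" where
  "graph_b k G =
    (\<Sum>W | W \<subseteq> pverts G \<and> card W = k. (int (num_components (with_proj G \<restriction> W)) - 1))"

text \<open>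
  In \<open>connected_sum t G1 G2 G\<close>, \<^const>\<open>complete_digraph\<close> \<open>t\<close> says that the induced subgraph is
  complete on \<open>t\<close> vertices. The set \<open>V2'\<close> is finite because \<open>\<sigma>\<close> is a bijection from the finite
  vertex set of \<open>G2\<close> onto it.
\<close>

definition connected_sum ::
  "nat \<Rightarrow> 'a pair_pre_digraph \<Rightarrow> 'b pair_pre_digraph \<Rightarrow> 'a pair_pre_digraph \<Rightarrow> bool" where
  "connected_sum t G1 G2 G \<longleftrightarrow>
    (\<exists>F1 F2 V2' \<sigma>.
      F1 \<subseteq> pverts G1 \<and> F2 \<subseteq> pverts G2 \<and> card F1 = t \<and> card F2 = t \<and>
      complete_digraph t (with_proj G1 \<restriction> F1) \<and> complete_digraph t (with_proj G2 \<restriction> F2) \<and>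
      bij_betw \<sigma> (pverts G2) V2' \<and> pverts G1 \<inter> V2' = F1 \<and> \<sigma> ` F2 = F1 \<and>
      G = \<lparr> pverts = pverts G1 \<union> V2',
            parcs = parcs G1 \<union> {(\<sigma> x, \<sigma> y) | x y. (x, y) \<in> parcs G2} \<rparr>)"

lemma num_components_null: "num_components (G \<restriction> {}) = 0"
proof -
  have "pre_digraph.sccs (G \<restriction> {}) = {}"
    by (auto simp: pre_digraph.sccs_def induced_subgraph_def subgraph_def strongly_connected_def)
  then show ?thesis by (simp add: num_components_def)
qed

lemma graph_b_0:
  assumes "pair_graph G"
  shows "graph_b 0 G = -1"
proof -
  interpret pair_graph G by fact
  have "{W. W \<subseteq> pverts G \<and> card W = 0} = {{}}"
    using pair_finite_verts by (auto dest: finite_subset)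
  then show ?thesis by (simp add: graph_b_def num_components_null)
qed

lemma graph_b_eq_0:
  assumes "pair_graph G" "card (pverts G) < k"
  shows "graph_b k G = 0"
proof -
  interpret pair_graph G by fact
  have "{W. W \<subseteq> pverts G \<and> card W = k} = {}"
    using card_mono[OF pair_finite_verts] assms(2) by (auto simp: not_le[symmetric])
  then show ?thesis unfolding graph_b_def by (simp only: sum.empty)
qed

lemma connected_sum_pair_graph:
  assumes "pair_graph G1" "pair_graph G2" "connected_sum t G1 G2 G"
  shows "pair_graph G"
proof -
  interpret G1: pair_graph G1 by fact
  interpret G2: pair_graph G2 by fact
  obtain V2' \<sigma> where bij: "bij_betw \<sigma> (pverts G2) V2'"
    and G: "G = \<lparr> pverts = pverts G1 \<union> V2',
      parcs = parcs G1 \<union> {(\<sigma> x, \<sigma> y) | x y. (x, y) \<in> parcs G2} \<rparr>"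
    using assms(3) unfolding connected_sum_def by blast
  have eq: "{(\<sigma> x, \<sigma> y) | x y. (x, y) \<in> parcs G2} = map_prod \<sigma> \<sigma> ` parcs G2"
    by (auto simp: image_iff)
  have inj: "inj_on \<sigma> (pverts G2)" and V2': "V2' = \<sigma> ` pverts G2"
    using bij by (auto simp: bij_betw_def)
  have sym: "sym (parcs G1)" "sym (parcs G2)"
    using G1.pair_sym_arcs G2.pair_sym_arcs by (simp_all add: symmetric_def)
  show ?thesis
  proof
    show "symmetric (with_proj G)"
      using sym unfolding symmetric_def G by (simp add: sym_def) blast
    show "finite (pverts G)"
      using G1.pair_finite_verts G2.pair_finite_verts by (simp add: G V2')
    show "finite (parcs G)"
      using G1.pair_finite_arcs G2.pair_finite_arcs by (simp add: G eq)
    show "fst e \<noteq> snd e" if "e \<in> parcs G" for e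
      using that inj G1.pair_no_loops G2.pair_no_loops G2.in_arcsD1 G2.in_arcsD2
      by (fastforce simp: G inj_on_eq_iff)
    show "fst e \<in> pverts G" if "e \<in> parcs G" for e
      using that G1.arc_fst_in_verts G2.in_arcsD1 by (auto simp: G V2')
    show "snd e \<in> pverts G" if "e \<in> parcs G" for e
      using that G1.arc_snd_in_verts G2.in_arcsD2 by (auto simp: G V2')
  qed
qed

end

theory Submission
  imports Defs
begin

text \<open>
  Identify \<open>G2\<close> with its copy on \<open>V2'\<close>. For \<open>W\<close> a set of vertices of the sum, the components of
  \<open>G1\<close> on \<open>W \<inter> V1\<close> and of \<open>G2\<close> on \<open>W \<inter> V2'\<close> that miss the clique \<open>F1\<close> are components of the sum, and
  if \<open>W\<close> meets \<open>F1\<close>, then on each side exactly one component meets \<open>F1\<close> and these two are glued.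
  Hence \<open>nc W - 1 = (nc1 (W \<inter> V1) - 1) + (nc2 (W \<inter> V2') - 1) + [W \<inter> F1 = {}]\<close>. Summing over
  \<open>W\<close> of size \<open>k\<close>, a set \<open>A \<subseteq> V1\<close> of size \<open>i\<close> is \<open>W \<inter> V1\<close> for \<open>(n2 - t) choose (k - i)\<close> sets \<open>W\<close>.
\<close>

section \<open>Components of an edge relation restricted to a set\<close>

text \<open>Stated for a bare relation rather than a graph, so that restricting \<open>W\<close>,
  taking the union of two relations and renaming vertices need no graph construction. For symmetric
  \<open>E\<close> these are the connected components of the graph induced on
  \<open>W\<close>.\<close>

definition components_on :: "'a set \<Rightarrow> 'a rel \<Rightarrow> 'a set set" where
  "components_on W E = {S. S \<noteq> {} \<and> S \<subseteq> W \<and> S \<times> S \<subseteq> rtrancl_on W E \<and> E `` S \<inter> W \<subseteq> S}"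

lemma components_on_reachable:
  assumes "S \<in> components_on W E" "u \<in> S" "(u, v) \<in> rtrancl_on W E"
  shows "v \<in> S"
  using assms(3,1,2) by (induct rule: rtrancl_on_induct) (auto simp: components_on_def)

lemma components_on_subset: "S \<in> components_on W E \<Longrightarrow> S \<subseteq> W"
  by (simp add: components_on_def)

lemma components_on_closed:
  "S \<in> components_on W E \<Longrightarrow> u \<in> S \<Longrightarrow> (u, v) \<in> E \<Longrightarrow> v \<in> W \<Longrightarrow> v \<in> S"
  by (auto simp: components_on_def)

lemma components_on_eq:
  assumes "S \<in> components_on W E" "T \<in> components_on W E" "u \<in> S" "u \<in> T"
  shows "S = T"
proof -
  have reach: "S \<times> S \<subseteq> rtrancl_on W E" "T \<times> T \<subseteq> rtrancl_on W E"
    using assms by (simp_all add: components_on_def)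
  have "S \<subseteq> T" using components_on_reachable[OF assms(2,4)] reach(1) assms(3) by blast
  moreover have "T \<subseteq> S" using components_on_reachable[OF assms(1,3)] reach(2) assms(4) by blast
  ultimately show ?thesis by blast
qed

text \<open>Components sharing a vertex coincide, so a family of components covering
  \<open>W\<close> leaves no room for another one. Later proofs determine all components by
  exhibiting such a family.\<close>

lemma components_on_eqI:
  assumes "P \<subseteq> components_on W E" "W \<subseteq> \<Union>P"
  shows "components_on W E = P"
proof
  show "components_on W E \<subseteq> P"
  proof
    fix S assume S: "S \<in> components_on W E"
    then obtain u where u: "u \<in> S" "u \<in> W" by (auto simp: components_on_def)
    then obtain p where "p \<in> P" "u \<in> p" using assms(2) by auto
    then show "S \<in> P" using components_on_eq[OF S _ u(1)] assms(1) by blast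
  qed
qed (fact assms(1))

text \<open>The witness is the set of vertices reachable from \<open>u\<close> within
  \<open>W\<close>; symmetry lets two of its members reach each other through
  \<open>u\<close>.\<close>

lemma components_on_cover:
  assumes "sym E" "u \<in> W"
  obtains S where "S \<in> components_on W E" "u \<in> S"
proof
  let ?S = "{v. (u, v) \<in> rtrancl_on W E}"
  show "u \<in> ?S" using assms by simp
  have "(v, w) \<in> rtrancl_on W E" if "v \<in> ?S" "w \<in> ?S" for v w
    using that rtrancl_on_sym[OF assms(1)] by (auto elim: symE intro: rtrancl_on_trans)
  then show "?S \<in> components_on W E"
    using assms(2)
    by (auto simp: components_on_def dest: in_rtrancl_on_in_F
        intro: rtrancl_on_into_rtrancl_on)
qed

lemma finite_components_on: "finite W \<Longrightarrow> finite (components_on W E)"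
  by (rule finite_subset[of _ "Pow W"]) (auto simp: components_on_def)

lemma rtrancl_on_image:
  assumes "(u, v) \<in> rtrancl_on W E"
  shows "(f u, f v) \<in> rtrancl_on (f ` W) (map_prod f f ` E)"
  using assms
proof (induct rule: rtrancl_on_induct)
  case (step y z)
  then have "(f y, f z) \<in> map_prod f f ` E" by force
  then show ?case using step by (blast intro: rtrancl_on_into_rtrancl_on)
qed simp

lemma components_on_image:
  assumes "sym E" "E \<subseteq> V \<times> V" "inj_on f V" "W \<subseteq> V"
  shows "components_on (f ` W) (map_prod f f ` E) = (`) f ` components_on W E"
proof (rule components_on_eqI)
  show "(`) f ` components_on W E \<subseteq> components_on (f ` W) (map_prod f f ` E)"
  proof safe
    fix S assume S: "S \<in> components_on W E"
    then have "S \<subseteq> V" using assms(4) by (auto simp: components_on_def)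
    have "(map_prod f f ` E) `` (f ` S) \<inter> f ` W \<subseteq> f ` S"
    proof
      fix b assume "b \<in> (map_prod f f ` E) `` (f ` S) \<inter> f ` W"
      then obtain x' x y w where b: "x' \<in> S" "(x, y) \<in> E" "f x' = f x" "w \<in> W" "b = f y" "b = f w"
        by auto
      \<comment> \<open>Both ends of the arc lie in \<open>V\<close> because \<open>E\<close> does,
        so injectivity on \<open>V\<close> identifies the preimages of each end.\<close>
      have "x' = x"
        using inj_onD[OF assms(3) b(3)] b(1,2) \<open>S \<subseteq> V\<close> assms(2) by blast
      moreover have "y = w"
        using inj_onD[OF assms(3), of y w] b assms(2,4) by blast
      ultimately show "b \<in> f ` S" using b S by (auto simp: components_on_def)
    qed
    then show "f ` S \<in> components_on (f ` W) (map_prod f f ` E)"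
      using S by (auto simp: components_on_def intro!: rtrancl_on_image)
  qed
  show "f ` W \<subseteq> \<Union> ((`) f ` components_on W E)"
  proof (rule image_subsetI)
    fix u assume "u \<in> W"
    then obtain S where "S \<in> components_on W E" "u \<in> S" by (rule components_on_cover[OF assms(1)])
    then show "f u \<in> \<Union> ((`) f ` components_on W E)" by blast
  qed
qed

lemma card_components_on_image:
  assumes "sym E" "E \<subseteq> V \<times> V" "inj_on f V" "W \<subseteq> V"
  shows "card (components_on (f ` W) (map_prod f f ` E)) = card (components_on W E)"
proof -
  have "inj_on ((`) f) (components_on W E)"
    by (rule inj_on_subset[OF inj_on_image_Pow[OF assms(3)]])
      (use assms(4) in \<open>auto simp: components_on_def\<close>)
  then show ?thesis by (simp add: components_on_image[OF assms] card_image)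
qed

section \<open>Gluing along a clique\<close>

text \<open>An arc of \<open>E2\<close> starts in \<open>V2\<close>, which \<open>S\<close> misses,
  so only arcs of \<open>E1\<close> leave vertices of \<open>S\<close>, and those end in
  \<open>V1\<close>, where \<open>S\<close> is already closed.\<close>

lemma components_on_glue_disjoint:
  assumes E: "E1 \<subseteq> V1 \<times> V1" "E2 \<subseteq> V2 \<times> V2"
    and S: "S \<in> components_on (W \<inter> V1) E1" "S \<inter> V2 = {}"
  shows "S \<in> components_on W (E1 \<union> E2)"
proof -
  have "(u, v) \<in> rtrancl_on W (E1 \<union> E2)" if "u \<in> S" "v \<in> S" for u v
    using that S(1) rtrancl_on_mono[of E1 "E1 \<union> E2" "W \<inter> V1" W u v]
    by (auto simp: components_on_def)
  moreover have "(E1 \<union> E2) `` S \<inter> W \<subseteq> S"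
    using E S by (auto simp: components_on_def)
  ultimately show ?thesis using S(1) by (auto simp: components_on_def)
qed

text \<open>The shared vertex \<open>f\<close> connects the two parts. For closure, a vertex of the
  union lying in \<open>V1\<close> is in \<open>C1\<close>: otherwise it is in \<open>C2\<close>,
  hence in both vertex sets, and \<open>F\<close> puts it in \<open>C1\<close> after all. The same
  holds for \<open>V2\<close> and \<open>C2\<close>.\<close>

lemma components_on_glue_meeting:
  assumes E: "E1 \<subseteq> V1 \<times> V1" "E2 \<subseteq> V2 \<times> V2"
    and C1: "C1 \<in> components_on (W \<inter> V1) E1" and C2: "C2 \<in> components_on (W \<inter> V2) E2"
    and F: "W \<inter> V1 \<inter> V2 \<subseteq> C1 \<inter> C2" and f: "f \<in> W \<inter> V1 \<inter> V2"
  shows "C1 \<union> C2 \<in> components_on W (E1 \<union> E2)"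
proof -
  let ?R = "rtrancl_on W (E1 \<union> E2)"
  have sub: "C1 \<subseteq> W \<inter> V1" "C2 \<subseteq> W \<inter> V2"
    using C1 C2 by (auto dest: components_on_subset)
  have "(u, v) \<in> ?R" if "u \<in> C1" "v \<in> C1" for u v
    using that C1 rtrancl_on_mono[of E1 "E1 \<union> E2" "W \<inter> V1" W u v]
    by (auto simp: components_on_def)
  moreover have "(u, v) \<in> ?R" if "u \<in> C2" "v \<in> C2" for u v
    using that C2 rtrancl_on_mono[of E2 "E1 \<union> E2" "W \<inter> V2" W u v]
    by (auto simp: components_on_def)
  ultimately have to_f: "(u, f) \<in> ?R" "(f, u) \<in> ?R" if "u \<in> C1 \<union> C2" for u
    using that F f by blast+
  have "(C1 \<union> C2) \<times> (C1 \<union> C2) \<subseteq> ?R"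
  proof clarify
    fix u v assume "u \<in> C1 \<union> C2" "v \<in> C1 \<union> C2"
    then show "(u, v) \<in> ?R" using to_f by (blast intro: rtrancl_on_trans)
  qed
  moreover have "(E1 \<union> E2) `` (C1 \<union> C2) \<inter> W \<subseteq> C1 \<union> C2"
  proof
    fix y assume "y \<in> (E1 \<union> E2) `` (C1 \<union> C2) \<inter> W"
    then obtain x where x: "x \<in> C1 \<union> C2" "(x, y) \<in> E1 \<union> E2" and y: "y \<in> W" by blast
    have "x \<in> W" using x(1) sub by blast
    from x(2) show "y \<in> C1 \<union> C2"
    proof
      assume xy: "(x, y) \<in> E1"
      then have "x \<in> V1" "y \<in> V1" using E by auto
      then have "x \<in> C1" using x(1) sub F \<open>x \<in> W\<close> by blast
      then show ?thesis using components_on_closed[OF C1 _ xy] y \<open>y \<in> V1\<close> by blast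
    next
      assume xy: "(x, y) \<in> E2"
      then have "x \<in> V2" "y \<in> V2" using E by auto
      then have "x \<in> C2" using x(1) sub F \<open>x \<in> W\<close> by blast
      then show ?thesis using components_on_closed[OF C2 _ xy] y \<open>y \<in> V2\<close> by blast
    qed
  qed
  moreover have "C1 \<union> C2 \<noteq> {}" "C1 \<union> C2 \<subseteq> W" using sub F f by blast+
  ultimately show ?thesis by (simp add: components_on_def)
qed

lemma clique_subset_component:
  assumes "C \<in> components_on W E" "f \<in> C" "f \<in> F"
    and "\<And>x y. x \<in> F \<Longrightarrow> y \<in> F \<Longrightarrow> x \<noteq> y \<Longrightarrow> (x, y) \<in> E"
  shows "W \<inter> F \<subseteq> C"
proof
  fix y assume "y \<in> W \<inter> F"
  then show "y \<in> C"
    using components_on_closed[OF assms(1,2), of y] assms(2,3) assms(4)[of f y] by (cases "y = f") auto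
qed

text \<open>The clique puts all of \<open>W \<inter> (V1 \<inter> V2)\<close>, if non-empty, into a
  single component on each side, and merging these two loses exactly one component. The correction
  is added on the left to avoid subtraction on natural numbers.\<close>

lemma card_components_on_glue:
  assumes sym: "sym E1" "sym E2"
    and E: "E1 \<subseteq> V1 \<times> V1" "E2 \<subseteq> V2 \<times> V2"
    and clique1: "\<And>x y. x \<in> V1 \<inter> V2 \<Longrightarrow> y \<in> V1 \<inter> V2 \<Longrightarrow> x \<noteq> y \<Longrightarrow> (x, y) \<in> E1"
    and clique2: "\<And>x y. x \<in> V1 \<inter> V2 \<Longrightarrow> y \<in> V1 \<inter> V2 \<Longrightarrow> x \<noteq> y \<Longrightarrow> (x, y) \<in> E2"
    and W: "finite W" "W \<subseteq> V1 \<union> V2"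
  shows "card (components_on W (E1 \<union> E2)) + of_bool (W \<inter> (V1 \<inter> V2) \<noteq> {})
    = card (components_on (W \<inter> V1) E1) + card (components_on (W \<inter> V2) E2)"
proof -
  let ?K1 = "components_on (W \<inter> V1) E1" and ?K2 = "components_on (W \<inter> V2) E2"
  have fin: "finite ?K1" "finite ?K2" using W by (auto intro: finite_components_on)
  have K1: "S \<noteq> {} \<and> S \<subseteq> W \<inter> V1" if "S \<in> ?K1" for S
    using that by (auto simp: components_on_def)
  have K2: "S \<noteq> {} \<and> S \<subseteq> W \<inter> V2" if "S \<in> ?K2" for S
    using that by (auto simp: components_on_def)
  have glue1: "S \<in> components_on W (E1 \<union> E2)" if "S \<in> ?K1" "S \<inter> V2 = {}" for S
    using components_on_glue_disjoint[OF E that] .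
  have glue2: "S \<in> components_on W (E1 \<union> E2)" if "S \<in> ?K2" "S \<inter> V1 = {}" for S
    using components_on_glue_disjoint[OF E(2,1) that] by (simp add: Un_commute)
  have cover: "W \<subseteq> \<Union>(?K1 \<union> ?K2)"
  proof
    fix u assume "u \<in> W"
    then consider "u \<in> W \<inter> V1" | "u \<in> W \<inter> V2" using W by auto
    then show "u \<in> \<Union>(?K1 \<union> ?K2)"
      using components_on_cover[OF sym(1)] components_on_cover[OF sym(2)] by cases (metis UnCI UnionI)+
  qed
  show ?thesis
  proof (cases "W \<inter> (V1 \<inter> V2) = {}")
    case True
    have "components_on W (E1 \<union> E2) = ?K1 \<union> ?K2"
      using cover True K1 K2 by (intro components_on_eqI) (blast intro: glue1 glue2)+
    moreover have "?K1 \<inter> ?K2 = {}" using True K1 K2 by blast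
    ultimately show ?thesis using fin True by (simp add: card_Un_disjoint)
  next
    case False
    then obtain f where f: "f \<in> W \<inter> V1 \<inter> V2" by blast
    obtain C1 where C1: "C1 \<in> ?K1" "f \<in> C1" using components_on_cover[OF sym(1), of f "W \<inter> V1"] f by blast
    obtain C2 where C2: "C2 \<in> ?K2" "f \<in> C2" using components_on_cover[OF sym(2), of f "W \<inter> V2"] f by blast
    have F1: "W \<inter> V1 \<inter> V2 \<subseteq> C1"
      using clique_subset_component[OF C1, of "V1 \<inter> V2"] clique1 f by blast
    have F2: "W \<inter> V1 \<inter> V2 \<subseteq> C2"
      using clique_subset_component[OF C2, of "V1 \<inter> V2"] clique2 f by blast
    \<comment> \<open>These are the components away from the clique: one that met the other side
      would contain a vertex of \<open>C1\<close> or \<open>C2\<close> respectively and so equal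
      it.\<close>
    let ?L1 = "?K1 - {C1}" and ?L2 = "?K2 - {C2}"
    have L1: "S \<noteq> {} \<and> S \<inter> V2 = {}" if "S \<in> ?L1" for S
      using that K1[of S] F1 components_on_eq[OF C1(1), of S] by blast
    have L2: "S \<noteq> {} \<and> S \<inter> V1 = {}" if "S \<in> ?L2" for S
      using that K2[of S] F2 components_on_eq[OF C2(1), of S] by blast
    have C: "C1 \<union> C2 \<in> components_on W (E1 \<union> E2)"
      using components_on_glue_meeting[OF E C1(1) C2(1) _ f] F1 F2 by blast
    have "S \<in> components_on W (E1 \<union> E2)" if "S \<in> ?L1" for S
      using L1[OF that] glue1[of S] that by simp
    moreover have "S \<in> components_on W (E1 \<union> E2)" if "S \<in> ?L2" for S
      using L2[OF that] glue2[of S] that by simp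
    ultimately have "insert (C1 \<union> C2) (?L1 \<union> ?L2) \<subseteq> components_on W (E1 \<union> E2)"
      using C by blast
    moreover have "W \<subseteq> \<Union>(insert (C1 \<union> C2) (?L1 \<union> ?L2))"
      by (rule subset_trans[OF cover]) auto
    ultimately have "components_on W (E1 \<union> E2) = insert (C1 \<union> C2) (?L1 \<union> ?L2)"
      by (rule components_on_eqI)
    moreover have "?L1 \<inter> ?L2 = {}"
    proof (intro equals0I, elim IntE)
      fix S assume S: "S \<in> ?L1" "S \<in> ?L2"
      then have "S \<subseteq> V1" using K1[of S] by simp
      then show False using L2[OF S(2)] by blast
    qed
    moreover have "C1 \<union> C2 \<notin> ?L1" using L1[of "C1 \<union> C2"] f C1(2) by blast
    moreover have "C1 \<union> C2 \<notin> ?L2" using L2[of "C1 \<union> C2"] f C2(2) by blast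
    moreover have "card ?K1 = Suc (card ?L1)" "card ?K2 = Suc (card ?L2)"
      using card.remove[OF fin(1) C1(1)] card.remove[OF fin(2) C2(1)] by simp_all
    ultimately show ?thesis using fin False by (simp add: card_Un_disjoint)
  qed
qed

section \<open>Sums over subsets of given size\<close>

text \<open>A subset of \<open>U \<union> D\<close> is a unique union of some
  \<open>A \<subseteq> U\<close> and \<open>B \<subseteq> D\<close>. The summand sees only
  \<open>A\<close>, so each \<open>A\<close> of size \<open>i\<close> counts once for every
  \<open>B\<close> of size \<open>k - i\<close>.\<close>

lemma sum_subsets_Int:
  fixes g :: "'a set \<Rightarrow> int"
  assumes "finite U" "finite D" "U \<inter> D = {}"
  shows "(\<Sum>W | W \<subseteq> U \<union> D \<and> card W = k. g (W \<inter> U)) =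
    (\<Sum>i=0..k. (\<Sum>A | A \<subseteq> U \<and> card A = i. g A) * int (card D choose (k - i)))"
proof -
  have card_Un: "card (A \<union> B) = card A + card B" if "A \<subseteq> U" "B \<subseteq> D" for A B
    using that assms by (intro card_Un_disjoint) (auto dest: finite_subset)
  have card_split: "card W = card (W \<inter> U) + card (W \<inter> D)" if "W \<subseteq> U \<union> D" for W
    using card_Un[of "W \<inter> U" "W \<inter> D"] that by (simp add: Int_Un_distrib[symmetric] Int_absorb2)
  have fin: "finite {A. A \<subseteq> U \<and> card A = i}" "finite {B. B \<subseteq> D \<and> card B = i}" for i
    using assms by simp_all
  have "(\<Sum>i=0..k. (\<Sum>A | A \<subseteq> U \<and> card A = i. g A) * int (card D choose (k - i))) =
    (\<Sum>i=0..k. \<Sum>(A, B)\<in>{A. A \<subseteq> U \<and> card A = i} \<times> {B. B \<subseteq> D \<and> card B = k - i}. g A)"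
    by (simp add: sum.cartesian_product[symmetric] n_subsets[OF assms(2)] sum_distrib_left
        mult.commute)
  also have "\<dots> = (\<Sum>(i, A, B)\<in>(SIGMA i:{0..k}. {A. A \<subseteq> U \<and> card A = i} \<times>
      {B. B \<subseteq> D \<and> card B = k - i}). g A)"
    using fin by (subst sum.Sigma) auto
  \<comment> \<open>The triples \<open>(i, A, B)\<close> correspond bijectively to the sets
    \<open>A \<union> B\<close>, since \<open>i\<close> is determined as the size of
    \<open>A\<close>.\<close>
  also have "\<dots> = (\<Sum>W | W \<subseteq> U \<union> D \<and> card W = k. g (W \<inter> U))"
    by (rule sum.reindex_bij_witness[where i = "\<lambda>W. (card (W \<inter> U), W \<inter> U, W \<inter> D)"
          and j = "\<lambda>(i, A, B). A \<union> B"])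
      (use assms(3) in \<open>auto simp: card_Un card_split intro!: arg_cong[where f = g]
        arg_cong[where f = card]\<close>)
  finally show ?thesis by simp
qed

lemma card_subsets_disjoint:
  assumes "finite V"
  shows "(\<Sum>W | W \<subseteq> V \<and> card W = k. of_bool (W \<inter> F = {})) = int (card (V - F) choose k)"
proof -
  have "(\<Sum>W | W \<subseteq> V \<and> card W = k. of_bool (W \<inter> F = {}) :: int) =
    int (card ({W. W \<subseteq> V \<and> card W = k} \<inter> {W. W \<inter> F = {}}))"
    using assms by (simp add: sum_of_bool_eq)
  also have "{W. W \<subseteq> V \<and> card W = k} \<inter> {W. W \<inter> F = {}} = {W. W \<subseteq> V - F \<and> card W = k}"
    by auto
  finally show ?thesis using assms by (simp add: n_subsets)
qed

section \<open>The connected sum formula\<close>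

text \<open>Links the strong components of the library to \<open>components_on\<close>: reachability
  in the induced subgraph is \<open>rtrancl_on W (parcs G)\<close>, and since this relation is
  symmetric, reachability one way is already mutual.\<close>

lemma num_components_conv_components_on:
  assumes "pair_graph G"
  shows "num_components (with_proj G \<restriction> W) = card (components_on W (parcs G))"
proof -
  interpret pair_graph G by fact
  let ?H = "with_proj G \<restriction> W"
  interpret H: wf_digraph ?H by (rule wellformed_induce_subgraph)
  have reach: "u \<rightarrow>\<^sup>*\<^bsub>?H\<^esub> v \<longleftrightarrow> (u, v) \<in> rtrancl_on W (parcs G)" for u v
  proof
    show "(u, v) \<in> rtrancl_on W (parcs G)" if "u \<rightarrow>\<^sup>*\<^bsub>?H\<^esub> v"
      using that rtrancl_on_mono[of "arcs_ends ?H" "parcs G" "verts ?H" W u v]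
      by (auto simp: arcs_ends_conv reachable_def)
    show "u \<rightarrow>\<^sup>*\<^bsub>?H\<^esub> v" if "(u, v) \<in> rtrancl_on W (parcs G)"
      using that
    proof (induct rule: rtrancl_on_induct)
      case (step y z)
      then have "y \<rightarrow>\<^bsub>?H\<^esub> z" by (force simp: arcs_ends_conv)
      then show ?case using step by (blast intro: H.reachable_adj_trans)
    qed auto
  qed
  have sym: "sym (rtrancl_on W (parcs G))"
    using pair_sym_arcs by (intro rtrancl_on_sym) (simp add: symmetric_def)
  have "H.sccs_verts = components_on W (parcs G)"
  proof (intro subset_antisym subsetI)
    fix S assume S: "S \<in> H.sccs_verts"
    then have "S \<subseteq> W" using H.sccs_verts_subsets by auto
    moreover have "v \<in> S" if "u \<in> S" "(u, v) \<in> parcs G" "v \<in> W" for u v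
    proof -
      have "(u, v) \<in> rtrancl_on W (parcs G)"
        using that \<open>S \<subseteq> W\<close> by (auto intro: rtrancl_on_into_rtrancl_on)
      then show ?thesis
        using S that(1) sym unfolding H.in_sccs_verts_conv_reachable reach by (blast dest: symD)
    qed
    ultimately show "S \<in> components_on W (parcs G)"
      using S unfolding H.in_sccs_verts_conv_reachable reach components_on_def by blast
  next
    fix S assume S: "S \<in> components_on W (parcs G)"
    then show "S \<in> H.sccs_verts"
      using components_on_reachable[OF S]
      unfolding H.in_sccs_verts_conv_reachable reach components_on_def by blast
  qed
  then show ?thesis by (simp add: num_components_def flip: H.card_sccs_verts)
qed

lemma graph_b_conv_components_on:
  assumes "pair_graph G"
  shows "graph_b k G =
    (\<Sum>W | W \<subseteq> pverts G \<and> card W = k. int (card (components_on W (parcs G))) - 1)"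
  by (simp add: graph_b_def num_components_conv_components_on[OF assms])

text \<open>Expresses \<open>graph_b\<close> through a renamed copy of the graph. \<open>G2\<close>
  has its own vertex type, and this brings it to the type of \<open>G1\<close>, where the two can be
  glued.\<close>

lemma graph_b_image:
  assumes "pair_graph G" "inj_on f (pverts G)"
  shows "graph_b k G = (\<Sum>W | W \<subseteq> f ` pverts G \<and> card W = k.
    int (card (components_on W (map_prod f f ` parcs G))) - 1)"
proof -
  interpret pair_graph G by fact
  have sym: "sym (parcs G)" using pair_sym_arcs by (simp add: symmetric_def)
  have parcs: "parcs G \<subseteq> pverts G \<times> pverts G" using in_arcsD1 in_arcsD2 by auto
  have "bij_betw ((`) f) {W. W \<subseteq> pverts G \<and> card W = k} {W. W \<subseteq> f ` pverts G \<and> card W = k}"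
    unfolding bij_betw_def
  proof
    show "inj_on ((`) f) {W. W \<subseteq> pverts G \<and> card W = k}"
      by (rule inj_on_subset[OF inj_on_image_Pow[OF assms(2)]]) auto
    have "card (f ` W) = card W" if "W \<subseteq> pverts G" for W
      using that assms(2) by (auto intro: card_image inj_on_subset)
    then show "(`) f ` {W. W \<subseteq> pverts G \<and> card W = k} = {W. W \<subseteq> f ` pverts G \<and> card W = k}"
      by (auto simp: subset_image_iff)
  qed
  then show ?thesis
    unfolding graph_b_conv_components_on[OF assms(1)]
    by (subst sum.reindex_bij_betw[symmetric, where h = "(`) f"])
      (auto simp: card_components_on_image[OF sym parcs assms(2)])
qed

theorem theorem3p2:
  fixes G1 G :: "'a pair_pre_digraph" and G2 :: "'b pair_pre_digraph" and n1 n2 t k :: nat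
  assumes "pair_graph G1" and "pair_graph G2"
    and "card (pverts G1) = n1" and "card (pverts G2) = n2"
    and "t > 0"
    and "connected_sum t G1 G2 G"
  shows "graph_b k G =
    (\<Sum>i=0..k. graph_b i G1 * int ((n2 - t) choose (k - i))
             + graph_b i G2 * int ((n1 - t) choose (k - i)))
    + int ((n1 + n2 - 2 * t) choose k)"
proof -
  interpret G1: pair_graph G1 by fact
  interpret G2: pair_graph G2 by fact
  obtain F1 F2 V2 \<sigma> where F: "F1 \<subseteq> pverts G1" "F2 \<subseteq> pverts G2" "card F1 = t" "card F2 = t"
    and complete: "complete_digraph t (with_proj G1 \<restriction> F1)" "complete_digraph t (with_proj G2 \<restriction> F2)"
    and bij: "bij_betw \<sigma> (pverts G2) V2" and Int: "pverts G1 \<inter> V2 = F1" and \<sigma>F2: "\<sigma> ` F2 = F1"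
    and G: "G = \<lparr> pverts = pverts G1 \<union> V2,
      parcs = parcs G1 \<union> {(\<sigma> x, \<sigma> y) | x y. (x, y) \<in> parcs G2} \<rparr>"
    using assms(6) unfolding connected_sum_def by blast
  \<comment> \<open>From here on \<open>V2\<close> and \<open>E2\<close> describe the copy of
    \<open>G2\<close> under \<open>\<sigma>\<close>, and the clique \<open>F1\<close> is
    \<open>V1 \<inter> V2\<close>.\<close>
  define V1 E1 E2 where "V1 = pverts G1" and "E1 = parcs G1" and "E2 = map_prod \<sigma> \<sigma> ` parcs G2"
  have inj: "inj_on \<sigma> (pverts G2)" and V2: "V2 = \<sigma> ` pverts G2"
    using bij by (auto simp: bij_betw_def)
  have "{(\<sigma> x, \<sigma> y) | x y. (x, y) \<in> parcs G2} = E2"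
    by (auto simp: E2_def image_iff)
  then have G: "pverts G = V1 \<union> V2" "parcs G = E1 \<union> E2"
    by (simp_all add: G V1_def E1_def)
  have F1: "F1 = V1 \<inter> V2" using Int by (simp add: V1_def)
  have fin: "finite V1" "finite V2"
    using G1.pair_finite_verts G2.pair_finite_verts by (simp_all add: V1_def V2)
  have n: "card V1 = n1" "card V2 = n2" "card (V1 \<inter> V2) = t"
    using assms(3,4) F(3) bij_betw_same_card[OF bij] F1 by (simp_all add: V1_def)
  have sym: "sym E1" "sym E2"
    using G1.pair_sym_arcs G2.pair_sym_arcs by (auto simp: E1_def E2_def symmetric_def sym_def)
  have E: "E1 \<subseteq> V1 \<times> V1" "E2 \<subseteq> V2 \<times> V2"
    using G1.in_arcsD1 G1.in_arcsD2 G2.in_arcsD1 G2.in_arcsD2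
    by (auto simp: E1_def E2_def V1_def V2)
  have clique1: "(x, y) \<in> E1" if "x \<in> V1 \<inter> V2" "y \<in> V1 \<inter> V2" "x \<noteq> y" for x y
    using complete(1) that unfolding complete_digraph_def F1 E1_def by (auto simp: arcs_ends_conv)
  have clique2: "(x, y) \<in> E2" if xy: "x \<in> V1 \<inter> V2" "y \<in> V1 \<inter> V2" "x \<noteq> y" for x y
  proof -
    obtain x' y' where "x' \<in> F2" "y' \<in> F2" and eq: "x = \<sigma> x'" "y = \<sigma> y'"
      using xy \<sigma>F2 F1 by blast
    then have "(x', y') \<in> parcs G2"
      using complete(2) xy(3) unfolding complete_digraph_def by (auto simp: arcs_ends_conv)
    then show ?thesis by (force simp: E2_def eq)
  qed
  define g1 g2 where "g1 A = int (card (components_on A E1)) - 1"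
    and "g2 A = int (card (components_on A E2)) - 1" for A
  have b1: "graph_b i G1 = (\<Sum>A | A \<subseteq> V1 \<and> card A = i. g1 A)" for i
    by (simp add: graph_b_conv_components_on[OF assms(1)] g1_def V1_def E1_def)
  have b2: "graph_b i G2 = (\<Sum>A | A \<subseteq> V2 \<and> card A = i. g2 A)" for i
    by (simp add: graph_b_image[OF assms(2) inj] g2_def V2 E2_def)
  \<comment> \<open>Each of the three counts carries a \<open>-1\<close>. Splitting the one on the
    left into two leaves a surplus \<open>1\<close>, which the merged component cancels unless
    \<open>W\<close> misses the clique.\<close>
  have b: "int (card (components_on W (E1 \<union> E2))) - 1 =
      g1 (W \<inter> V1) + g2 (W \<inter> V2) + of_bool (W \<inter> (V1 \<inter> V2) = {})" if "W \<subseteq> V1 \<union> V2" for W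
    using card_components_on_glue[OF sym E clique1 clique2 _ that] finite_subset[OF that] fin
    by (cases "W \<inter> (V1 \<inter> V2) = {}") (simp_all add: g1_def g2_def)
  \<comment> \<open>Two disjoint splittings of the vertex set, one for each use of
    \<open>sum_subsets_Int\<close>.\<close>
  have U1: "V1 \<union> V2 = V1 \<union> (V2 - V1)" and U2: "V1 \<union> V2 = V2 \<union> (V1 - V2)"
    by auto
  have D: "card (V2 - V1) = n2 - t" "card (V1 - V2) = n1 - t"
    using n fin by (simp_all add: card_Diff_subset_Int Int_commute)
  \<comment> \<open>The clique is counted twice in \<open>n1 + n2\<close> and removed once more from
    the union, which gives the \<open>2 * t\<close> of the last binomial.\<close>
  have "card (V1 \<union> V2) + t = n1 + n2" using card_Un_Int[OF fin] n by simp
  moreover have "card (V1 \<union> V2 - V1 \<inter> V2) = card (V1 \<union> V2) - t"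
    using fin n by (subst card_Diff_subset) auto
  ultimately have D': "card (V1 \<union> V2 - V1 \<inter> V2) = n1 + n2 - 2 * t" by simp
  have "graph_b k G = (\<Sum>W | W \<subseteq> V1 \<union> V2 \<and> card W = k. g1 (W \<inter> V1)) +
    (\<Sum>W | W \<subseteq> V1 \<union> V2 \<and> card W = k. g2 (W \<inter> V2)) +
    (\<Sum>W | W \<subseteq> V1 \<union> V2 \<and> card W = k. of_bool (W \<inter> (V1 \<inter> V2) = {}))"
    unfolding graph_b_conv_components_on[OF connected_sum_pair_graph[OF assms(1,2,6)]] G
    by (simp add: b sum.distrib)
  also have "(\<Sum>W | W \<subseteq> V1 \<union> V2 \<and> card W = k. g1 (W \<inter> V1)) =
    (\<Sum>i=0..k. graph_b i G1 * int ((n2 - t) choose (k - i)))"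
    unfolding U1 b1 by (subst sum_subsets_Int) (use fin D in auto)
  also have "(\<Sum>W | W \<subseteq> V1 \<union> V2 \<and> card W = k. g2 (W \<inter> V2)) =
    (\<Sum>i=0..k. graph_b i G2 * int ((n1 - t) choose (k - i)))"
    unfolding U2 b2 by (subst sum_subsets_Int) (use fin D in auto)
  also have "(\<Sum>W | W \<subseteq> V1 \<union> V2 \<and> card W = k. of_bool (W \<inter> (V1 \<inter> V2) = {})) =
    int ((n1 + n2 - 2 * t) choose k)"
    using fin D' by (subst card_subsets_disjoint) auto
  finally show ?thesis by (simp add: sum.distrib)
qed

end
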